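(* Let $d\ge2$, let $\vartheta>\frac{d+1}{2}$, let $a\in L^\infty_\vartheta(\mathbb{R}^d)$ be a divergence-free vector field, and let $u\in\mathcal{C}_w([0,T];L^\infty_{\underline{\vartheta}})$, $\underline{\vartheta}=\min\{\vartheta;d+1\}$, be the mild solution of the Navier--Stokes system (NS) with initial datum $a$. Let $K(t)=(K_{h,k}(t))_{1\le h,k\le d}$ with $K_{h,k}(t)=\int_0^t\int_{\mathbb{R}^d}(u_hu_k)(y,s)\,dy\,ds$, and $$\Pi(x,t)=\gamma_d\sum_{h,k=1}^d\left(\frac{\delta_{h,k}}{d\,|x|^d}-\frac{x_hx_k}{|x|^{d+2}}\right)K_{h,k}(t),\qquad \gamma_d=\pi^{-d/2}\,\Gamma\left(\tfrac{d+2}{2}\right).$$ Then, for any $t\in[0,T]$, the homogeneous function $x\mapsto\nabla\Pi(x,t)$ vanishes identically on $\mathbb{R}^d\setminus\{0\}$ if and only if the matrix $K(t)$ is proportional to the identity matrix, i.e. $$\forall\, h,k\in\{1,\dots,d\},\qquad K_{h,k}(t)=\alpha(t)\,\delta_{h,k},\qquad\text{with }\alpha=\tfrac1d\operatorname{Tr}K .$$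
   Context: (NS) is the system on $\mathbb{R}^d$: $\partial_t u-\Delta u+(u\cdot\nabla)u=-\nabla p$, $\operatorname{div}u=0$, $u(x,0)=a(x)$. For $\vartheta\ge0$, $L^\infty_\vartheta$ is the space of measurable functions (or vector fields) $f$ on $\mathbb{R}^d$ with $\|f\|_{L^\infty_\vartheta}=\operatorname{ess\,sup}_x(1+|x|)^\vartheta|f(x)|<\infty$. $\mathcal{C}_w([0,T];L^\infty_\vartheta)$ is the space of $u(x,t)$ with $u(t)\in L^\infty_\vartheta$ for all $t$, continuous in $t>0$ for the $L^\infty_\vartheta$ norm, with $u(t)\to u(0)$ in the distributional sense as $t\to0$; its elements are understood to be bounded in $L^\infty_\vartheta$ on $[0,T]$. A mild solution satisfies $u(t)=e^{t\Delta}a-\int_0^te^{(t-s)\Delta}\mathbb{P}\operatorname{div}(u\otimes u)(s)\,ds$, with $\mathbb{P}f=f-\nabla\Delta^{-1}(\operatorname{div}f)$. It is known that every divergence-free $a\in L^\infty_\vartheta$ gives rise, on some $[0,T]$ with $T>0$, to a unique mild solution in $\mathcal{C}_w([0,T];L^\infty)$, and this solution belongs to $\mathcal{C}_w([0,T];L^\infty_{\underline{\vartheta}})$. $\delta_{h,k}$ is the Kronecker symbol and $\nabla$ is the gradient in $x$. *)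

theory Defs
  imports "HOL-Probability.Essential_Supremum"
begin

text \<open>Space is \<open>real ^ 'd\<close>, so the dimension is \<open>CARD('d)\<close>. A time-dependent field \<open>u(x,t)\<close> is
  curried with time first, \<open>u t x\<close>. Elements of the Lebesgue spaces are represented by functions,
  and equalities between them are required almost everywhere.\<close>

subsection \<open>Weighted spaces\<close>

definition linf_norm :: "real \<Rightarrow> (real ^ 'd \<Rightarrow> real ^ 'd) \<Rightarrow> ennreal"
  where "linf_norm \<theta> f = esssup lebesgue (\<lambda>x. ennreal ((1 + norm x) powr \<theta> * norm (f x)))"

definition linf_space :: "real \<Rightarrow> (real ^ 'd \<Rightarrow> real ^ 'd) set"
  where "linf_space \<theta> = {f. f \<in> borel_measurable lebesgue \<and> linf_norm \<theta> f < \<infinity>}"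

subsection \<open>Test functions and distributions\<close>

definition partial_deriv :: "'d \<Rightarrow> (real ^ 'd \<Rightarrow> real) \<Rightarrow> real ^ 'd \<Rightarrow> real"
  where "partial_deriv i f x = frechet_derivative f (at x) (axis i 1)"

primrec C_k :: "nat \<Rightarrow> (real ^ 'd \<Rightarrow> real) \<Rightarrow> bool" where
  "C_k 0 f \<longleftrightarrow> continuous_on UNIV f"
| "C_k (Suc k) f \<longleftrightarrow> (\<forall>x. f differentiable (at x)) \<and> (\<forall>i. C_k k (partial_deriv i f))"

definition test_functions :: "(real ^ 'd \<Rightarrow> real) set"
  where "test_functions = {\<phi>. (\<forall>k. C_k k \<phi>) \<and> compact (closure {x. \<phi> x \<noteq> 0})}"

text \<open>The divergence vanishes in the sense of distributions.\<close>

definition divergence_free :: "(real ^ 'd \<Rightarrow> real ^ 'd) \<Rightarrow> bool"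
  where "divergence_free a \<longleftrightarrow>
    (\<forall>\<phi>\<in>test_functions. (LINT x|lebesgue. (\<Sum>i\<in>UNIV. a x $ i * partial_deriv i \<phi> x)) = 0)"

text \<open>The space \<open>C_w([0,T]; L^\<infinity>_\<theta>)\<close>; the bound on the whole of \<open>[0,T]\<close> is part of the definition,
  since it does not follow from continuity on \<open>(0,T]\<close> and weak convergence at \<open>0\<close>.\<close>

definition Cw_space :: "real \<Rightarrow> real \<Rightarrow> (real \<Rightarrow> real ^ 'd \<Rightarrow> real ^ 'd) set"
  where "Cw_space T \<theta> = {u.
    (\<forall>t\<in>{0..T}. u t \<in> linf_space \<theta>) \<and>
    (SUP t\<in>{0..T}. linf_norm \<theta> (u t)) < \<infinity> \<and>
    (\<forall>t\<in>{0<..T}. ((\<lambda>s. linf_norm \<theta> (\<lambda>x. u s x - u t x)) \<longlongrightarrow> 0) (at t within {0<..T})) \<and>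
    (\<forall>\<phi>\<in>test_functions.
      ((\<lambda>t. LINT x|lebesgue. \<phi> x *\<^sub>R u t x) \<longlongrightarrow> (LINT x|lebesgue. \<phi> x *\<^sub>R u 0 x)) (at 0 within {0<..T}))}"

subsection \<open>Mild solutions of the Navier--Stokes system\<close>

definition heat_kernel :: "real \<Rightarrow> real ^ 'd \<Rightarrow> real"
  where "heat_kernel t x = (4 * pi * t) powr (- real CARD('d) / 2) * exp (- (norm x)\<^sup>2 / (4 * t))"

definition heat_semigroup :: "real \<Rightarrow> (real ^ 'd \<Rightarrow> real ^ 'd) \<Rightarrow> real ^ 'd \<Rightarrow> real ^ 'd"
  where "heat_semigroup t a x =
    (if t = 0 then a x else LINT y|lebesgue. heat_kernel t (x - y) *\<^sub>R a y)"

definition inverse_fourier :: "(real ^ 'd \<Rightarrow> complex) \<Rightarrow> real ^ 'd \<Rightarrow> complex"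
  where "inverse_fourier m x =
    complex_of_real (1 / (2 * pi) ^ CARD('d)) * (LINT \<xi>|lebesgue. cis (x \<bullet> \<xi>) * m \<xi>)"

text \<open>The symbol of \<open>\<P> f = f - \<nabla>\<Delta>\<^sup>-\<^sup>1(div f)\<close>: here \<open>\<nabla>\<close>, \<open>div\<close> and \<open>\<Delta>\<close> have the symbols \<open>i \<xi>\<close>,
  \<open>i \<xi> \<bullet>\<close> and \<open>-|\<xi>|\<^sup>2\<close>.\<close>

definition leray_symbol :: "'d \<Rightarrow> 'd \<Rightarrow> real ^ 'd \<Rightarrow> real"
  where "leray_symbol j k \<xi> = of_bool (j = k) - \<xi> $ j * \<xi> $ k / (norm \<xi>)\<^sup>2"

text \<open>On bounded matrix fields \<open>w\<close>, the operator \<open>e\<^sup>t\<^sup>\<Delta> \<P> div\<close> (\<open>t > 0\<close>) is the convolution with the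
  kernel whose Fourier transform is its symbol: the \<open>j\<close>-th component of the result is
  \<open>\<Sum>h k. F j h k t * w h k\<close>, where \<open>(div w) k = \<Sum>h. \<partial>h (w h k)\<close>. For \<open>t > 0\<close> the symbol is
  integrable, the kernel is integrable in space, and the inverse Fourier transform is real
  (the symbol is odd and purely imaginary).\<close>

definition oseen_div_kernel :: "'d \<Rightarrow> 'd \<Rightarrow> 'd \<Rightarrow> real \<Rightarrow> real ^ 'd \<Rightarrow> real"
  where "oseen_div_kernel j h k t x = Re (inverse_fourier
    (\<lambda>\<xi>. complex_of_real (exp (- t * (norm \<xi>)\<^sup>2) * leray_symbol j k \<xi>) * (\<i> * complex_of_real (\<xi> $ h))) x)"

definition heat_leray_div :: "real \<Rightarrow> (real ^ 'd \<Rightarrow> real ^ 'd ^ 'd) \<Rightarrow> real ^ 'd \<Rightarrow> real ^ 'd"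
  where "heat_leray_div t w x =
    (\<chi> j. LINT y|lebesgue. (\<Sum>h\<in>UNIV. \<Sum>k\<in>UNIV. oseen_div_kernel j h k t (x - y) * w y $ h $ k))"

definition tensor :: "real ^ 'd \<Rightarrow> real ^ 'd \<Rightarrow> real ^ 'd ^ 'd"
  where "tensor v w = (\<chi> h k. v $ h * w $ k)"

definition mild_solution ::
    "real \<Rightarrow> (real ^ 'd \<Rightarrow> real ^ 'd) \<Rightarrow> (real \<Rightarrow> real ^ 'd \<Rightarrow> real ^ 'd) \<Rightarrow> bool"
  where "mild_solution T a u \<longleftrightarrow> (\<forall>t\<in>{0..T}. AE x in lebesgue.
    u t x = heat_semigroup t a x
      - (LINT s:{0..t}|lebesgue. heat_leray_div (t - s) (\<lambda>y. tensor (u s y) (u s y)) x))"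

subsection \<open>The matrix \<open>K\<close> and the profile \<open>\<Pi>\<close>\<close>

definition K_matrix :: "(real \<Rightarrow> real ^ 'd \<Rightarrow> real ^ 'd) \<Rightarrow> real \<Rightarrow> real ^ 'd ^ 'd"
  where "K_matrix u t =
    (\<chi> h k. LINT s:{0..t}|lebesgue. (LINT y|lebesgue. u s y $ h * u s y $ k))"

definition Pi_profile :: "(real \<Rightarrow> real ^ 'd \<Rightarrow> real ^ 'd) \<Rightarrow> real ^ 'd \<Rightarrow> real \<Rightarrow> real"
  where "Pi_profile u x t =
    pi powr (- real CARD('d) / 2) * Gamma ((real CARD('d) + 2) / 2) *
    (\<Sum>h\<in>UNIV. \<Sum>k\<in>UNIV.
      (of_bool (h = k) / (real CARD('d) * norm x ^ CARD('d)) - x $ h * x $ k / norm x ^ (CARD('d) + 2))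
      * K_matrix u t $ h $ k)"

end

(*
  With \<alpha> = Tr K / d, the profile is \<Pi>(x) = \<gamma>_d (\<alpha> |x|^2 - x . K x) / |x|^(d+2), which is homogeneous
  of degree -d. If its gradient vanishes away from the origin, \<Pi> takes the same value at x and at
  2x; homogeneity forces this value to be 0, so the quadratic form of K is \<alpha> |x|^2, and since K is
  symmetric, polarization gives K = \<alpha> I. Conversely, K = \<alpha> I makes \<Pi> vanish identically.
*)

theory Submission
  imports Defs
begin

text \<open>Along the open ray from the origin through \<open>x\<close>, which is convex and avoids
  the origin, the chain rule gives derivative zero, so \<open>f\<close> is constant there. Hence
  \<open>f x = f (r *\<^sub>R x) = c * f x\<close> with \<open>c\<close> different from 1.\<close>

lemma zero_if_GDERIV_zero_and_scaling:
  fixes f :: "'a::real_inner \<Rightarrow> real"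
  assumes grad: "\<And>y. y \<noteq> 0 \<Longrightarrow> GDERIV f y :> 0"
    and scaling: "f (r *\<^sub>R x) = c * f x"
    and "r > 0" "c \<noteq> 1" "x \<noteq> 0"
  shows "f x = 0"
proof -
  have "((\<lambda>s. f (s *\<^sub>R x)) has_derivative (\<lambda>_. 0)) (at s within {0<..})"
    if "s \<in> {0<..}" for s
  proof -
    have "(f has_derivative (\<lambda>_. 0)) (at (s *\<^sub>R x))"
      using grad[of "s *\<^sub>R x"] that \<open>x \<noteq> 0\<close> by (simp add: gderiv_def)
    moreover have "((\<lambda>s. s *\<^sub>R x) has_derivative (\<lambda>h. h *\<^sub>R x)) (at s within {0<..})"
      by (auto intro!: derivative_eq_intros)
    ultimately show ?thesis
      using has_derivative_compose by blast
  qed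
  then obtain C where "\<And>s. s \<in> {0<..} \<Longrightarrow> f (s *\<^sub>R x) = C"
    using has_derivative_zero_constant[of "{0<..}" "\<lambda>s. f (s *\<^sub>R x)"] by auto
  from this[of r] this[of 1] have "f (r *\<^sub>R x) = f x"
    using \<open>r > 0\<close> by simp
  with scaling \<open>c \<noteq> 1\<close> show ?thesis
    by (metis mult_cancel_right1)
qed

lemma inner_matrix_vector_eq_sum:
  fixes A :: "real ^ 'n ^ 'n"
  shows "x \<bullet> (A *v x) = (\<Sum>h\<in>UNIV. \<Sum>k\<in>UNIV. x $ h * x $ k * A $ h $ k)"
  by (simp add: inner_vec_def matrix_vector_mult_def sum_distrib_left mult_ac)

text \<open>Polarization: basis vectors read off the diagonal entries, and sums of two of them read
  off the others.\<close>

lemma symmetric_matrix_eq_scaled_identityI: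
  fixes A :: "real ^ 'n ^ 'n"
  assumes sym: "\<And>h k. A $ h $ k = A $ k $ h"
    and form: "\<And>x. x \<noteq> 0 \<Longrightarrow> x \<bullet> (A *v x) = \<alpha> * (norm x)\<^sup>2"
  shows "A $ h $ k = \<alpha> * of_bool (h = k)"
proof -
  have form': "x \<bullet> (A *v x) = \<alpha> * (x \<bullet> x)" for x
    using form by (cases "x = 0") (auto simp: power2_norm_eq_inner)
  have entry: "axis i 1 \<bullet> (A *v axis j 1) = A $ i $ j" for i j
    by (simp add: inner_axis' matrix_vector_mult_basis column_def)
  have diag: "A $ i $ i = \<alpha>" for i
    using form'[of "axis i 1"] by (simp add: entry inner_axis_axis)
  \<comment> \<open>At e_h + e_k the form gives A_hh + A_hk + A_kh + A_kk = 2 \<alpha>. The diagonal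
    entries already account for 2 \<alpha>, so symmetry leaves 2 A_hk = 0.\<close>
  have "A $ h $ k = 0" if "h \<noteq> k"
    using form'[of "axis h 1 + axis k 1"] that sym[of h k] diag
    by (simp add: matrix_vector_right_distrib inner_add_left inner_add_right entry inner_axis_axis)
  with diag show ?thesis by auto
qed

lemma K_matrix_symmetric: "K_matrix u t $ h $ k = K_matrix u t $ k $ h"
  by (simp add: K_matrix_def mult.commute)

lemma Pi_profile_eq_quadratic_form:
  fixes u :: "real \<Rightarrow> real ^ 'd \<Rightarrow> real ^ 'd"
  shows "Pi_profile u x t =
    pi powr (- real CARD('d) / 2) * Gamma ((real CARD('d) + 2) / 2) *
    ((trace (K_matrix u t) / real CARD('d) * (norm x)\<^sup>2 - x \<bullet> (K_matrix u t *v x))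
      / norm x ^ (CARD('d) + 2))"
proof -
  let ?K = "K_matrix u t" and ?d = "CARD('d)"
  have trace: "(\<Sum>h\<in>UNIV. \<Sum>k\<in>UNIV. of_bool (h = k) / c * ?K $ h $ k) = trace ?K / c" for c
    by (simp add: trace_def of_bool_def if_distrib if_distribR sum_divide_distrib cong: if_cong)
  have "(\<Sum>h\<in>UNIV. \<Sum>k\<in>UNIV.
      (of_bool (h = k) / (real ?d * norm x ^ ?d) - x $ h * x $ k / norm x ^ (?d + 2)) * ?K $ h $ k)
    = trace ?K / (real ?d * norm x ^ ?d) - (x \<bullet> (?K *v x)) / norm x ^ (?d + 2)"
    by (simp only: left_diff_distrib sum_subtractf trace)
       (simp add: inner_matrix_vector_eq_sum sum_divide_distrib)
  \<comment> \<open>At the origin both sides are 0, since division by zero yields 0; elsewhere this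
    is a common denominator.\<close>
  also have "\<dots> = (trace ?K / real ?d * (norm x)\<^sup>2 - x \<bullet> (?K *v x)) / norm x ^ (?d + 2)"
    by (cases "x = 0") (simp_all add: field_simps power_add power2_eq_square)
  finally show ?thesis
    by (simp add: Pi_profile_def)
qed

text \<open>The numerator of the quadratic-form expression has degree 2 and the denominator degree d
  + 2; \<open>r > 0\<close> gives |r| = r and allows r^2 to be cancelled.\<close>

lemma Pi_profile_scaleR:
  fixes u :: "real \<Rightarrow> real ^ 'd \<Rightarrow> real ^ 'd"
  assumes "r > 0"
  shows "Pi_profile u (r *\<^sub>R x) t = Pi_profile u x t / r ^ CARD('d)"
proof -
  have "(\<alpha> * (norm (r *\<^sub>R x))\<^sup>2 - r *\<^sub>R x \<bullet> (A *v (r *\<^sub>R x))) / norm (r *\<^sub>R x) ^ (CARD('d) + 2)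
    = (\<alpha> * (norm x)\<^sup>2 - x \<bullet> (A *v x)) / norm x ^ (CARD('d) + 2) / r ^ CARD('d)"
    for \<alpha> and A :: "real ^ 'd ^ 'd"
  proof -
    have num: "\<alpha> * (norm (r *\<^sub>R x))\<^sup>2 - r *\<^sub>R x \<bullet> (A *v (r *\<^sub>R x))
        = r\<^sup>2 * (\<alpha> * (norm x)\<^sup>2 - x \<bullet> (A *v x))"
      by (simp add: matrix_vector_mult_scaleR power_mult_distrib algebra_simps power2_eq_square)
    have den: "norm (r *\<^sub>R x) ^ (CARD('d) + 2) = r\<^sup>2 * (norm x ^ (CARD('d) + 2) * r ^ CARD('d))"
      using assms by (simp add: power_mult_distrib power_add power2_eq_square)
    show ?thesis
      unfolding num den using assms by simp
  qed
  then show ?thesis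
    by (simp only: Pi_profile_eq_quadratic_form times_divide_eq_right)
qed

text \<open>The constant \<gamma>_d is nonzero because Gamma is positive on positive reals. At the
  origin both sides hold, the profile being 0 there by convention.\<close>

lemma Pi_profile_eq_0_iff:
  fixes u :: "real \<Rightarrow> real ^ 'd \<Rightarrow> real ^ 'd"
  shows "Pi_profile u x t = 0 \<longleftrightarrow>
    x \<bullet> (K_matrix u t *v x) = trace (K_matrix u t) / real CARD('d) * (norm x)\<^sup>2"
proof -
  have "Gamma ((real CARD('d) + 2) / 2) \<noteq> 0"
    by (rule less_imp_neq[symmetric], rule Gamma_real_pos) simp
  then show ?thesis
    by (cases "x = 0") (auto simp: Pi_profile_eq_quadratic_form)
qed

theorem proposition1p6:
  fixes \<theta> T :: real
    and a :: "real ^ 'd \<Rightarrow> real ^ 'd"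
    and u :: "real \<Rightarrow> real ^ 'd \<Rightarrow> real ^ 'd"
  assumes "CARD('d) \<ge> 2"
    and "\<theta> > (real CARD('d) + 1) / 2"
    and "a \<in> linf_space \<theta>"
    and "divergence_free a"
    and "T > 0"
    and "u \<in> Cw_space T (min \<theta> (real CARD('d) + 1))"
    and "mild_solution T a u"
  shows "\<forall>t\<in>{0..T}.
    (\<forall>x. x \<noteq> 0 \<longrightarrow> GDERIV (\<lambda>y. Pi_profile u y t) x :> 0) \<longleftrightarrow>
    (\<forall>h k. K_matrix u t $ h $ k = trace (K_matrix u t) / real CARD('d) * of_bool (h = k))"
proof (intro ballI iffI)
  fix t
  let ?K = "K_matrix u t" and ?\<alpha> = "trace (K_matrix u t) / real CARD('d)"
  {
    assume grad: "\<forall>x. x \<noteq> 0 \<longrightarrow> GDERIV (\<lambda>y. Pi_profile u y t) x :> 0"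
    \<comment> \<open>The dilation factor 2 is a convenient choice: it multiplies the profile by
      2^(-d), which differs from 1 as d is positive.\<close>
    have "Pi_profile u x t = 0" if "x \<noteq> 0" for x
    proof (rule zero_if_GDERIV_zero_and_scaling
        [where f = "\<lambda>y. Pi_profile u y t" and r = 2 and c = "1 / 2 ^ CARD('d)"])
      show "Pi_profile u (2 *\<^sub>R x) t = 1 / 2 ^ CARD('d) * Pi_profile u x t"
        by (simp add: Pi_profile_scaleR)
      have "(2 :: real) ^ CARD('d) \<noteq> 1"
        by (rule less_imp_neq[symmetric], rule one_less_power) auto
      then show "1 / 2 ^ CARD('d) \<noteq> (1 :: real)"
        by simp
    qed (use grad that in auto)
    then show "\<forall>h k. ?K $ h $ k = ?\<alpha> * of_bool (h = k)"
      using symmetric_matrix_eq_scaled_identityI[OF K_matrix_symmetric]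
      by (metis Pi_profile_eq_0_iff)
  next
    assume K: "\<forall>h k. ?K $ h $ k = ?\<alpha> * of_bool (h = k)"
    have "?K = ?\<alpha> *\<^sub>R mat 1"
      using K by (simp add: vec_eq_iff mat_def)
    then have "?K *v x = ?\<alpha> *\<^sub>R x" for x
      by (metis matrix_vector_mul_lid scaleR_matrix_vector_assoc)
    \<comment> \<open>This covers the origin too, so the profile is literally the constant function
      0 and its gradient is that of a constant.\<close>
    then have "Pi_profile u x t = 0" for x
      by (simp add: Pi_profile_eq_0_iff power2_norm_eq_inner)
    then show "\<forall>x. x \<noteq> 0 \<longrightarrow> GDERIV (\<lambda>y. Pi_profile u y t) x :> 0"
      by (simp add: GDERIV_const)
  }
qed

end
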